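(* Let $n\ge 1$. For $1\le i\le n$ let $e_i\in\mathbb{Z}_2^n$ be the vector of Hamming weight $1$ with a $1$ in its $i$th coordinate, and let $E_i=\sum_{k=1}^{i} e_k$. Let $T=\{e_1,\ldots,e_n\}$ and $U=\{E_2,\ldots,E_n\}$. If $S\subseteq T\cup U$ satisfies $|S\cap U|\le 1$, then the Cayley graph $\Gamma(\mathbb{Z}_2^n,S)$ admits a unitary signing.
   Context: For $S \subseteq \mathbb{Z}_2^n$, the Cayley graph $\Gamma(\mathbb{Z}_2^n,S)$ has vertex set $\mathbb{Z}_2^n$ and edge set consisting of all unordered pairs $\{g,g+s\}$ with $g\in\mathbb{Z}_2^n$, $s\in S$ ($S$ need not span $\mathbb{Z}_2^n$). A unitary signing of a graph is a Hermitian matrix obtained from the adjacency matrix of the graph by replacing each nonzero entry by a complex number of absolute value $1$, so that the complex inner product of any two distinct rows is $0$. *)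

theory Defs
  imports Complex_Main "HOL-Library.Z2" "HOL-Library.Function_Algebras"
begin

text \<open>
  Vectors are functions on the coordinates \<open>1, \<dots>, n\<close>, extended by \<open>0\<close> outside this range, so that
  the pointwise addition of \<open>HOL-Library.Function_Algebras\<close> restricts to the group operation.
\<close>

definition Z2n :: "nat \<Rightarrow> (nat \<Rightarrow> bit) set" where
  "Z2n n = {x. \<forall>k. k \<notin> {1..n} \<longrightarrow> x k = 0}"

definition e_vec :: "nat \<Rightarrow> nat \<Rightarrow> bit" where
  "e_vec i = (\<lambda>k. if k = i then 1 else 0)"

definition E_vec :: "nat \<Rightarrow> nat \<Rightarrow> bit" where
  "E_vec i = (\<Sum>k = 1..i. e_vec k)"

definition T_set :: "nat \<Rightarrow> (nat \<Rightarrow> bit) set" where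
  "T_set n = e_vec ` {1..n}"

definition U_set :: "nat \<Rightarrow> (nat \<Rightarrow> bit) set" where
  "U_set n = E_vec ` {2..n}"

type_synonym 'v graph = "'v set \<times> 'v set set"

definition cayley_graph :: "nat \<Rightarrow> (nat \<Rightarrow> bit) set \<Rightarrow> (nat \<Rightarrow> bit) graph" where
  "cayley_graph n S = (Z2n n, {{g, g + s} | g s. g \<in> Z2n n \<and> s \<in> S})"

text \<open>
  Matrices are indexed directly by vertices; only the entries at pairs of vertices are relevant.
\<close>

definition adjacency_matrix :: "'v graph \<Rightarrow> 'v \<Rightarrow> 'v \<Rightarrow> complex" where
  "adjacency_matrix G u v = (if {u, v} \<in> snd G then 1 else 0)"

definition hermitian_on :: "'v set \<Rightarrow> ('v \<Rightarrow> 'v \<Rightarrow> complex) \<Rightarrow> bool" where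
  "hermitian_on V M \<longleftrightarrow> (\<forall>u\<in>V. \<forall>v\<in>V. M u v = cnj (M v u))"

text \<open>The vertex set is required to be finite because an infinite \<^const>\<open>sum\<close> would be \<open>0\<close>.\<close>

definition unitary_signing :: "'v graph \<Rightarrow> ('v \<Rightarrow> 'v \<Rightarrow> complex) \<Rightarrow> bool" where
  "unitary_signing G M \<longleftrightarrow>
     finite (fst G) \<and>
     hermitian_on (fst G) M \<and>
     (\<forall>u\<in>fst G. \<forall>v\<in>fst G.
        if adjacency_matrix G u v = 0 then M u v = 0 else cmod (M u v) = 1) \<and>
     (\<forall>u\<in>fst G. \<forall>v\<in>fst G. u \<noteq> v \<longrightarrow> (\<Sum>w\<in>fst G. M u w * cnj (M v w)) = 0)"

definition admits_unitary_signing :: "'v graph \<Rightarrow> bool" where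
  "admits_unitary_signing G \<longleftrightarrow> (\<exists>M. unitary_signing G M)"

lemma E_vec_apply: "E_vec i k = (if k \<in> {1..i} then 1 else 0)"
proof -
  have "(\<Sum>j\<in>A. e_vec j) k = (\<Sum>j\<in>A. e_vec j k)" if "finite A" for A
    using that by (induction rule: finite_induct) auto
  then show ?thesis by (simp add: E_vec_def e_vec_def)
qed

lemma T_set_Un_U_set_subset: "T_set n \<union> U_set n \<subseteq> Z2n n"
  by (auto simp: T_set_def U_set_def Z2n_def E_vec_apply) (auto simp: e_vec_def)

lemma Z2n_add: "x \<in> Z2n n \<Longrightarrow> y \<in> Z2n n \<Longrightarrow> x + y \<in> Z2n n"
  by (simp add: Z2n_def)

lemma finite_Z2n: "finite (Z2n n)"
proof -
  have U: "(UNIV :: bit set) = {0, 1}" using bit.exhaust by auto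
  have "Z2n n \<subseteq> {x. \<forall>k. (k \<in> {1..n} \<longrightarrow> x k \<in> {0, 1}) \<and> (k \<notin> {1..n} \<longrightarrow> x k = 0)}"
    using U by (auto simp: Z2n_def)
  then show ?thesis
    by (rule finite_subset) (intro finite_set_of_finite_funs; simp)
qed

end

theory Submission imports Defs begin

text \<open>
  For each \<open>s \<in> S\<close> take a Pauli matrix with shift part \<open>s\<close>, that is, the matrix with entries
  \<open>c s * (-1) ^ \<beta> s u\<close> at \<open>(u, u + s)\<close>, where \<open>\<beta> s\<close> is a linear functional and the unit
  \<open>c s\<close> makes the matrix Hermitian. Two of these matrices anticommute iff
  \<open>\<beta> s t + \<beta> t s = 1\<close>, and the sum of pairwise anticommuting Hermitian unitaries squares to a
  scalar matrix. On the standard basis the choice \<open>\<beta> e\<^sub>i e\<^sub>k = [k < i]\<close> works (Jordan-Wigner), and one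
  further vector \<open>v\<close> can always be added, because the conditions \<open>\<beta> v e\<^sub>i = 1 + \<beta> e\<^sub>i v\<close>
  merely prescribe the values of \<open>\<beta> v\<close> on a basis.
\<close>

definition bit_sign :: "bit \<Rightarrow> complex" where
  "bit_sign b = (if b = 0 then 1 else -1)"

lemma bit_sign_add: "bit_sign (a + b) = bit_sign a * bit_sign b"
  by (cases a; cases b) (auto simp: bit_sign_def)

lemma cnj_bit_sign [simp]: "cnj (bit_sign a) = bit_sign a"
  by (simp add: bit_sign_def)

text \<open>A square root of \<open>bit_sign b\<close>: with \<open>b = \<beta> s s\<close> it
  absorbs the sign by which the unscaled matrix with shift part \<open>s\<close> differs from its
  conjugate transpose.\<close>

definition bit_phase :: "bit \<Rightarrow> complex" where
  "bit_phase b = (if b = 0 then 1 else \<i>)"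

lemma cnj_bit_phase: "cnj (bit_phase b) = bit_sign b * bit_phase b"
  by (simp add: bit_phase_def bit_sign_def)

lemma bit_fun_add_self [simp]: "u + u = (0 :: 'a \<Rightarrow> bit)"
  by (simp add: fun_eq_iff)

lemma bit_fun_add_cancel [simp]:
  fixes u v :: "'a \<Rightarrow> bit"
  shows "u + (u + v) = v"
  by (simp add: fun_eq_iff flip: add.assoc)

lemma edge_cayley_graph_iff:
  assumes "u \<in> Z2n n" "v \<in> Z2n n"
  shows "{u, v} \<in> snd (cayley_graph n S) \<longleftrightarrow> u + v \<in> S"
proof
  assume "{u, v} \<in> snd (cayley_graph n S)"
  then obtain g s where "{u, v} = {g, g + s}" "s \<in> S"
    by (auto simp: cayley_graph_def)
  then show "u + v \<in> S"
    by (auto simp: doubleton_eq_iff ac_simps)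
next
  assume "u + v \<in> S"
  moreover have "{u, v} = {u, u + (u + v)}"
    by simp
  ultimately show "{u, v} \<in> snd (cayley_graph n S)"
    unfolding cayley_graph_def snd_conv using assms by blast
qed

text \<open>Additivity is asked only in the second argument: the first merely labels a matrix, so
  each functional \<open>\<beta> s\<close> can be chosen separately.\<close>

lemma anticommuting_imp_unitary_signing:
  fixes \<beta> :: "(nat \<Rightarrow> bit) \<Rightarrow> (nat \<Rightarrow> bit) \<Rightarrow> bit"
  assumes additive: "\<And>s x y. \<beta> s (x + y) = \<beta> s x + \<beta> s y"
    and anticommuting: "\<And>s t. s \<in> S \<Longrightarrow> t \<in> S \<Longrightarrow> s \<noteq> t \<Longrightarrow> \<beta> s t + \<beta> t s = 1"
  shows "admits_unitary_signing (cayley_graph n S)"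
proof -
  define c where "c s = bit_phase (\<beta> s s)" for s
  define M where
    "M u v = (if u + v \<in> S then c (u + v) * bit_sign (\<beta> (u + v) u) else 0)" for u v
  have cnj_c: "cnj (c s) = bit_sign (\<beta> s s) * c s" for s
    by (simp add: c_def cnj_bit_phase)
  have "M u v = cnj (M v u)" for u v
  proof -
    have "bit_sign (\<beta> s u) = bit_sign (\<beta> s (u + v)) * bit_sign (\<beta> s v)" for s
      by (simp only: additive bit_sign_add) (simp add: bit_sign_def)
    then show ?thesis
      unfolding M_def add.commute[of v u] by (simp add: cnj_c)
  qed
  then have hermitian: "hermitian_on V M" for V
    unfolding hermitian_on_def by blast
  have signing: "if adjacency_matrix (cayley_graph n S) u v = 0 then M u v = 0
      else cmod (M u v) = 1" if "u \<in> Z2n n" "v \<in> Z2n n" for u v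
    using that by (simp add: adjacency_matrix_def edge_cayley_graph_iff M_def c_def
        bit_phase_def bit_sign_def norm_mult)
  have orthogonal: "(\<Sum>w\<in>Z2n n. M u w * cnj (M v w)) = 0"
    if uv: "u \<in> Z2n n" "v \<in> Z2n n" "u \<noteq> v" for u v
  proof -
    \<comment> \<open>Exchanging the two paths of length two with steps \<open>s\<close> and \<open>t\<close> from \<open>u\<close> to \<open>v\<close> changes
      the sign of their contribution.\<close>
    have neg: "M u (u + v + w) * cnj (M v (u + v + w)) = - (M u w * cnj (M v w))" for w
    proof -
      define s t where "s = u + w" and "t = v + w"
      have st: "u + (u + v + w) = t" "v + (u + v + w) = s" "u + v = s + t" "s \<noteq> t"
        using uv(3) by (simp_all add: s_def t_def ac_simps)
      \<comment> \<open>Moves all signs to the base point \<open>v\<close>; the two contributions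
        then differ only in \<open>\<beta> t s\<close> against \<open>\<beta> s t\<close>.\<close>
      have flip: "bit_sign (\<beta> r u) = bit_sign (\<beta> r s) * bit_sign (\<beta> r t) * bit_sign (\<beta> r v)" for r
      proof -
        have "u = s + t + v"
          by (simp add: s_def t_def ac_simps)
        then show ?thesis
          by (simp only: additive bit_sign_add)
      qed
      show ?thesis
      proof (cases "s \<in> S \<and> t \<in> S")
        case True
        then have "bit_sign (\<beta> t s) = - bit_sign (\<beta> s t)"
          using anticommuting[of s t] st(4) by (cases "\<beta> s t"; cases "\<beta> t s") (auto simp: bit_sign_def)
        then show ?thesis
          using True unfolding M_def st(1,2) s_def[symmetric] t_def[symmetric]
          by (simp add: cnj_c flip[of s] flip[of t])
      next
        case False
        then show ?thesis
          by (auto simp: M_def st(1,2) simp flip: s_def t_def)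
      qed
    qed
    \<comment> \<open>Translation by \<open>u + v\<close> permutes the vertices, so the sum equals
      its own negative.\<close>
    have "(\<Sum>w\<in>Z2n n. M u w * cnj (M v w))
        = (\<Sum>w\<in>Z2n n. M u (u + v + w) * cnj (M v (u + v + w)))"
      using uv by (intro sum.reindex_bij_witness[of _ "\<lambda>w. u + v + w" "\<lambda>w. u + v + w"])
        (simp_all add: Z2n_add ac_simps)
    also have "\<dots> = - (\<Sum>w\<in>Z2n n. M u w * cnj (M v w))"
      by (simp only: neg sum_negf)
    finally show ?thesis
      by simp
  qed
  have "unitary_signing (cayley_graph n S) M"
    using hermitian signing orthogonal finite_Z2n
    by (simp add: unitary_signing_def) (simp add: cayley_graph_def)
  then show ?thesis
    unfolding admits_unitary_signing_def by blast
qed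

lemma basis_insert_admits_unitary_signing:
  assumes "v \<notin> T_set n" and "S \<subseteq> insert v (T_set n)"
  shows "admits_unitary_signing (cayley_graph n S)"
proof -
  \<comment> \<open>The second branch extends the Jordan-Wigner choice bilinearly. In the first, the
    coefficient of \<open>x i\<close> is the prescribed value
    \<open>1 + \<beta> (e_vec i) v\<close>.\<close>
  define \<beta> :: "(nat \<Rightarrow> bit) \<Rightarrow> (nat \<Rightarrow> bit) \<Rightarrow> bit" where
    "\<beta> s x = (if s = v then \<Sum>i\<in>{1..n}. (1 + (\<Sum>j\<in>{1..<i}. v j)) * x i
              else \<Sum>i\<in>{1..n}. s i * (\<Sum>j\<in>{1..<i}. x j))" for s x
  have not_v: "e_vec i \<noteq> v" if "i \<in> {1..n}" for i
    using that assms(1) by (auto simp: T_set_def)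
  have sum_e_vec: "(\<Sum>k\<in>{1..n}. e_vec i k * f k) = f i" if "i \<in> {1..n}" for i f
  proof -
    have "(\<Sum>k\<in>{1..n}. e_vec i k * f k) = (\<Sum>k\<in>{1..n}. if k = i then f k else 0)"
      by (intro sum.cong) (auto simp: e_vec_def)
    then show ?thesis
      using that by (simp only: sum.delta finite_atLeastAtMost if_True)
  qed
  have \<beta>_e: "\<beta> (e_vec i) x = (\<Sum>j\<in>{1..<i}. x j)" if "i \<in> {1..n}" for i x
    using not_v[OF that] by (simp only: \<beta>_def sum_e_vec[OF that] if_False)
  have \<beta>_v: "\<beta> v (e_vec i) = 1 + (\<Sum>j\<in>{1..<i}. v j)" if "i \<in> {1..n}" for i
    using that by (simp add: \<beta>_def e_vec_def if_distrib[of "\<lambda>a. _ * a"] cong: if_cong)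
  show ?thesis
  proof (rule anticommuting_imp_unitary_signing)
    show "\<beta> s (x + y) = \<beta> s x + \<beta> s y" for s x y
      unfolding \<beta>_def plus_fun_apply distrib_left sum.distrib by (cases "s = v") simp_all
  next
    fix s t assume st: "s \<in> S" "t \<in> S" "s \<noteq> t"
    have "r = v \<or> (\<exists>i\<in>{1..n}. r = e_vec i)" if "r \<in> S" for r
      using that assms(2) unfolding T_set_def by blast
    from this[OF st(1)] this[OF st(2)] consider i where "i \<in> {1..n}" "s = v" "t = e_vec i"
      | i where "i \<in> {1..n}" "s = e_vec i" "t = v"
      | i k where "i \<in> {1..n}" "k \<in> {1..n}" "s = e_vec i" "t = e_vec k" "i \<noteq> k"
      using st(3) by metis
    then show "\<beta> s t + \<beta> t s = 1"
    proof cases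
      case 1
      then show ?thesis by (simp add: \<beta>_e \<beta>_v add.assoc)
    next
      case 2
      then show ?thesis by (simp add: \<beta>_e \<beta>_v add.left_commute)
    next
      case 3
      \<comment> \<open>The two sums indicate \<open>k < i\<close> and \<open>i < k\<close>, exactly
        one of which holds.\<close>
      have "(\<Sum>j\<in>{1..<i}. e_vec k j) + (\<Sum>j\<in>{1..<k}. e_vec i j) = 1"
        using 3(1,2,5) by (cases i k rule: linorder_cases) (simp_all add: e_vec_def)
      then show ?thesis by (simp only: 3(3,4) \<beta>_e[OF 3(1)] \<beta>_e[OF 3(2)])
    qed
  qed
qed

theorem theorem1p2:
  fixes n :: nat and S :: "(nat \<Rightarrow> bit) set"
  assumes "n \<ge> 1"
    and "S \<subseteq> T_set n \<union> U_set n"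
    and "card (S \<inter> U_set n) \<le> 1"
  shows "admits_unitary_signing (cayley_graph n S)"
proof -
  have "finite (S \<inter> U_set n)"
    by (simp add: U_set_def)
  then consider "S \<inter> U_set n = {}" | v where "S \<inter> U_set n = {v}"
    using assms(3) by (metis card_0_eq card_1_singletonE le_eq_less_or_eq less_one)
  then show ?thesis
  proof cases
    case 1
    \<comment> \<open>Here \<open>S\<close> lies in the basis, and the zero vector serves as a dummy
      for \<open>v\<close>.\<close>
    have "e_vec i i \<noteq> 0 i" for i
      by (simp add: e_vec_def)
    then have "0 \<notin> T_set n"
      unfolding T_set_def by (metis (no_types) imageE)
    then show ?thesis
      by (rule basis_insert_admits_unitary_signing) (use 1 assms(2) in auto)
  next
    case (2 v)
    then have "v \<in> U_set n"
      by blast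
    then obtain m where m: "v = E_vec m" "m \<ge> 2"
      by (auto simp: U_set_def)
    have "v \<noteq> e_vec i" for i
    proof
      assume "v = e_vec i"
      \<comment> \<open>Since \<open>m \<ge> 2\<close>, \<open>E_vec m\<close> is 1 at both
        coordinates 1 and 2, unlike any \<open>e_vec i\<close>.\<close>
      then have "E_vec m 1 = e_vec i 1" "E_vec m 2 = e_vec i 2"
        using m(1) by metis+
      then show False
        using m(2) by (simp add: E_vec_apply e_vec_def split: if_splits)
    qed
    then have "v \<notin> T_set n"
      by (auto simp: T_set_def)
    then show ?thesis
      by (rule basis_insert_admits_unitary_signing) (use 2 assms(2) in auto)
  qed
qed

end
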